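(* Let $K$ be a compact subset of $B_1$. Then there exists $\varepsilon>0$, depending on $K$, such that $$\mathbb{P}\big[\mathcal{Z}_N(\beta)=0\text{ for some }\beta\in K\big]=O(N^{-\varepsilon}),\qquad N\to\infty.$$
   Context: Let $X_1,X_2,\ldots$ be independent real standard normal random variables. For $N\in\mathbb{N}$ put $n=\log N$ (natural logarithm) and $\mathcal{Z}_N(\beta)=\sum_{k=1}^N e^{\beta\sqrt n X_k}$, $\beta\in\mathbb{C}$. Write $\beta=\sigma+i\tau$ with $\sigma,\tau\in\mathbb{R}$. Define $B_2=\{\beta\colon 2\sigma^2>1,\ |\sigma|+|\tau|>\sqrt2\}$, $B_3=\{\beta\colon 2\sigma^2<1,\ \sigma^2+\tau^2>1\}$, and $B_1=\mathbb{C}\setminus\overline{B_2\cup B_3}$ (bar denotes closure). *)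

theory Defs
  imports "HOL-Probability.Probability"
begin

definition rem_partition :: "(nat \<Rightarrow> 'a \<Rightarrow> real) \<Rightarrow> nat \<Rightarrow> complex \<Rightarrow> 'a \<Rightarrow> complex" where
  "rem_partition X N \<beta> \<omega> = (\<Sum>k=1..N. exp (\<beta> * of_real (sqrt (ln (real N)) * X k \<omega>)))"

definition B2 :: "complex set" where
  "B2 = {\<beta>. 2 * (Re \<beta>)\<^sup>2 > 1 \<and> \<bar>Re \<beta>\<bar> + \<bar>Im \<beta>\<bar> > sqrt 2}"

definition B3 :: "complex set" where
  "B3 = {\<beta>. 2 * (Re \<beta>)\<^sup>2 < 1 \<and> (Re \<beta>)\<^sup>2 + (Im \<beta>)\<^sup>2 > 1}"

definition B1 :: "complex set" where
  "B1 = - closure (B2 \<union> B3)"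

(* For compact K the event that the partition function vanishes somewhere on K is an
   uncountable union of events; it is nevertheless measurable, so its measure in M is
   a genuine probability and not the default value 0 of a non-measurable set. *)
lemma rem_zero_event_measurable:
  fixes M :: "'a measure" and X :: "nat \<Rightarrow> 'a \<Rightarrow> real" and K :: "complex set"
  assumes X: "\<And>k. k \<ge> 1 \<Longrightarrow> X k \<in> borel_measurable M" and K: "compact K"
  shows "{\<omega> \<in> space M. \<exists>\<beta>\<in>K. rem_partition X N \<beta> \<omega> = 0} \<in> sets M"
proof -
  obtain D where D: "countable D" "D \<subseteq> K" "K \<subseteq> closure D"
    using separable by blast
  have cont: "continuous_on UNIV (\<lambda>\<beta>. rem_partition X N \<beta> \<omega>)" for \<omega>
    unfolding rem_partition_def by (intro continuous_intros)
  have meas: "(\<lambda>\<omega>. rem_partition X N \<beta> \<omega>) \<in> borel_measurable M" for \<beta>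
    unfolding rem_partition_def
  proof (rule borel_measurable_sum)
    fix k assume "k \<in> {1..N}"
    then have [measurable]: "X k \<in> borel_measurable M" using X by simp
    have h: "(\<lambda>x. exp (\<beta> * of_real (sqrt (ln (real N)) * x))) \<in> borel_measurable borel"
      by (intro borel_measurable_continuous_onI continuous_intros)
    show "(\<lambda>\<omega>. exp (\<beta> * of_real (sqrt (ln (real N)) * X k \<omega>))) \<in> borel_measurable M"
      by (rule measurable_compose[OF _ h]) measurable
  qed
  have eq: "(\<exists>\<beta>\<in>K. rem_partition X N \<beta> \<omega> = 0) \<longleftrightarrow>
      (\<forall>n::nat. \<exists>\<beta>\<in>D. norm (rem_partition X N \<beta> \<omega>) < 1 / real (Suc n))" (is "?L \<longleftrightarrow> ?R") for \<omega>
  proof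
    assume ?L
    then obtain b where b: "b \<in> K" "rem_partition X N b \<omega> = 0" by blast
    show ?R
    proof
      fix n :: nat
      have o: "open ((\<lambda>\<beta>. rem_partition X N \<beta> \<omega>) -` ball 0 (1 / real (Suc n)))"
        using cont by (intro open_vimage) auto
      have "b \<in> closure D" using b D by auto
      moreover have "b \<in> (\<lambda>\<beta>. rem_partition X N \<beta> \<omega>) -` ball 0 (1 / real (Suc n))"
        using b by simp
      ultimately have "D \<inter> ((\<lambda>\<beta>. rem_partition X N \<beta> \<omega>) -` ball 0 (1 / real (Suc n))) \<noteq> {}"
        using o closure_iff_nhds_not_empty by blast
      then show "\<exists>\<beta>\<in>D. norm (rem_partition X N \<beta> \<omega>) < 1 / real (Suc n)"
        by (auto simp: dist_norm)
    qed
  next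
    assume R: ?R
    then have ne: "K \<noteq> {}" using D by blast
    have "continuous_on K (\<lambda>\<beta>. norm (rem_partition X N \<beta> \<omega>))"
      using cont continuous_on_norm continuous_on_subset by blast
    from continuous_attains_inf[OF K ne this]
    obtain b where b: "b \<in> K"
      "\<forall>y\<in>K. norm (rem_partition X N b \<omega>) \<le> norm (rem_partition X N y \<omega>)" by blast
    have "rem_partition X N b \<omega> = 0"
    proof (rule ccontr)
      assume "rem_partition X N b \<omega> \<noteq> 0"
      then obtain n where "inverse (real (Suc n)) < norm (rem_partition X N b \<omega>)"
        using reals_Archimedean by (metis zero_less_norm_iff)
      moreover obtain y where "y \<in> D" "norm (rem_partition X N y \<omega>) < 1 / real (Suc n)"
        using R by blast
      ultimately show False using b D by (force simp: inverse_eq_divide)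
    qed
    then show ?L using b by blast
  qed
  have n: "(\<lambda>\<omega>. norm (rem_partition X N \<beta> \<omega>)) \<in> borel_measurable M" for \<beta>
    using meas by measurable
  have "{\<omega> \<in> space M. \<forall>n::nat. \<exists>\<beta>\<in>D. norm (rem_partition X N \<beta> \<omega>) < 1 / real (Suc n)} \<in> sets M"
    using D(1) n by (intro sets.sets_Collect_countable_All sets.sets_Collect_countable_Ex')
      (auto intro!: borel_measurable_less)
  then show ?thesis by (simp add: eq)
qed

end

theory Submission
  imports Defs "HOL-Complex_Analysis.Cauchy_Integral_Formula"
begin

text \<open>
  The ratio of the partition function \<open>Z\<close> to its mean is a random holomorphic function of \<open>\<beta>\<close>, and on
  \<open>B1\<close> it is close to \<open>1\<close>.  A zero of \<open>Z\<close> forces the ratio minus \<open>1\<close> to have modulus one, and by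
  Cauchy's formula this holds on average over a surrounding circle up to a factor two.  So the
  probability of a zero in a disc is bounded by the largest first absolute moment of the ratio minus
  \<open>1\<close> over a larger disc (\<open>random_holomorphic_zero_prob\<close>), and finitely many discs cover \<open>K\<close>.  It is
  therefore enough to bound \<open>E \<bar>Z / E Z - 1\<bar>\<close> by a negative power of \<open>N\<close>, locally uniformly on \<open>B1\<close>.

  Write \<open>\<sigma> = Re \<beta>\<close>, \<open>\<tau> = Im \<beta>\<close> and \<open>n = ln N\<close>.  By the Gaussian moment generating function,
  \<open>\<bar>E Z\<bar> = exp (n * (1 + (\<sigma>\<^sup>2 - \<tau>\<^sup>2) / 2))\<close>, and the variance of \<open>Z\<close> is at most
  \<open>exp (n * (1 + 2 * \<sigma>\<^sup>2))\<close>.  This gives the bound \<open>exp (n * (\<sigma>\<^sup>2 + \<tau>\<^sup>2 - 1) / 2)\<close>, good in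
  the open unit disc.  The rest of \<open>B1\<close> is contained in \<open>2 * \<sigma>\<^sup>2 > 1\<close>, \<open>\<bar>\<sigma>\<bar> + \<bar>\<tau>\<bar> < sqrt 2\<close>, where
  the variance comes from Gaussians so large that usually none of the \<open>N\<close> samples attains them.
  Each summand is therefore cut where the Gaussian reaches \<open>sqrt (2 * n)\<close>: the low part is treated in
  \<open>L2\<close>, the high part in \<open>L1\<close>, and both contribute deviations of order \<open>exp (n * sqrt 2 * \<bar>\<sigma>\<bar>)\<close>
  (\<open>rem_weight_truncation\<close>, \<open>iid_sum_L1_truncation\<close>).  Divided by \<open>\<bar>E Z\<bar>\<close>, this decays exactly when
  \<open>\<bar>\<tau>\<bar> < sqrt 2 - \<bar>\<sigma>\<bar>\<close>.  Both regimes are recorded by one continuous exponent, \<open>rem_rate\<close>, in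
  \<open>rem_L1_deviation\<close>; it is positive on \<open>B1\<close> by \<open>B1_imp_rate_pos\<close>.
\<close>

section \<open>Exponential moments of the standard normal law\<close>

text \<open>
  Completing the square moves a real tilt \<open>exp (u x)\<close> of the Gaussian density into a translation by
  \<open>u\<close>, so the complex argument reduces to the characteristic function.
\<close>

lemma complex_mgf_std_normal:
  fixes a :: complex
  shows "integrable std_normal_distribution (\<lambda>x. exp (a * of_real x))"
    and "(LINT x|std_normal_distribution. exp (a * of_real x)) = exp (a\<^sup>2 / 2)"
proof -
  define u v where "u = Re a" and "v = Im a"
  have a: "a = of_real u + \<i> * of_real v"
    by (simp add: u_def v_def complex_eq_iff)
  interpret D: real_distribution std_normal_distribution by (rule real_dist_normal_dist)
  have c: "integrable std_normal_distribution (\<lambda>x. iexp (v * x))"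
    by (rule D.integrable_iexp) auto
  have ch: "(LINT x|std_normal_distribution. iexp (v * x)) = complex_of_real (exp (- (v^2) / 2))"
    using char_std_normal_distribution unfolding char_def by metis
  let ?h = "\<lambda>x. std_normal_density x *\<^sub>R iexp (v * x)"
  have c': "integrable lborel ?h"
    using c by (subst (asm) integrable_density) auto
  have ch': "integral\<^sup>L lborel ?h = complex_of_real (exp (- (v^2) / 2))"
    using ch by (subst (asm) integral_density) auto
  have shift: "std_normal_density x *\<^sub>R exp (a * of_real x)
      = exp (of_real (u\<^sup>2 / 2) + \<i> * of_real (u * v)) * ?h (- u + 1 * x)" for x
  proof -
    have "std_normal_density x * exp (u * x) = exp (u\<^sup>2/2) * std_normal_density (x - u)"
      by (simp add: std_normal_density_def exp_add[symmetric] power2_eq_square field_simps)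
    moreover have "exp (a * of_real x) = of_real (exp (u * x)) * iexp (v * x)"
      by (simp add: a exp_of_real[symmetric] exp_add[symmetric] algebra_simps)
    ultimately have "std_normal_density x *\<^sub>R exp (a * of_real x)
        = of_real (exp (u\<^sup>2/2) * std_normal_density (x - u)) * iexp (v * x)"
      by (metis mult.assoc of_real_mult scaleR_conv_of_real)
    then show ?thesis
      by (simp add: scaleR_conv_of_real exp_of_real[symmetric] mult.left_commute exp_add[symmetric])
        (simp add: algebra_simps)
  qed
  have "integrable lborel (\<lambda>x. std_normal_density x *\<^sub>R exp (a * of_real x))"
    unfolding shift
    by (intro integrable_mult_right lborel_integrable_real_affine c') simp
  then show "integrable std_normal_distribution (\<lambda>x. exp (a * of_real x))"
    by (subst integrable_density) auto
  have "(LINT x|std_normal_distribution. exp (a * of_real x))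
      = (LINT x|lborel. std_normal_density x *\<^sub>R exp (a * of_real x))"
    by (subst integral_density) auto
  also have "\<dots> = exp (of_real (u\<^sup>2 / 2) + \<i> * of_real (u * v)) * integral\<^sup>L lborel ?h"
  proof -
    have "integral\<^sup>L lborel ?h = (LINT x|lborel. ?h (- u + 1 * x))"
      using lborel_integral_real_affine[of 1 ?h "- u"] by (simp only: abs_one scaleR_one)
    then show ?thesis unfolding shift by (simp only: integral_mult_right_zero)
  qed
  also have "\<dots> = exp (a\<^sup>2 / 2)"
    unfolding ch' exp_of_real[symmetric] exp_add[symmetric]
    by (rule arg_cong[of _ _ exp])
      (simp add: a power2_eq_square algebra_simps add_divide_distrib diff_divide_distrib)
  finally show "(LINT x|std_normal_distribution. exp (a * of_real x)) = exp (a\<^sup>2 / 2)" .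
qed

lemma mgf_std_normal:
  fixes u :: real
  shows "integrable std_normal_distribution (\<lambda>x. exp (u * x))"
    and "(LINT x|std_normal_distribution. exp (u * x)) = exp (u\<^sup>2 / 2)"
proof -
  have e: "exp (of_real u * of_real x) = complex_of_real (exp (u * x))" for x
    by (simp add: exp_of_real[symmetric])
  show "integrable std_normal_distribution (\<lambda>x. exp (u * x))"
    using complex_mgf_std_normal(1)[of "of_real u"] unfolding e by (simp only: complex_of_real_integrable_eq)
  have "complex_of_real (LINT x|std_normal_distribution. exp (u * x)) = of_real (exp (u\<^sup>2 / 2))"
    unfolding integral_complex_of_real[symmetric] e[symmetric] complex_mgf_std_normal(2)
    by (simp add: exp_of_real[symmetric])
  then show "(LINT x|std_normal_distribution. exp (u * x)) = exp (u\<^sup>2 / 2)"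
    by (simp only: of_real_eq_iff)
qed

section \<open>Mean deviation of sums of independent complex variables\<close>

lemma (in prob_space) expectation_le_sqrt_second_moment:
  fixes Y :: "'a \<Rightarrow> real"
  assumes "integrable M Y" "integrable M (\<lambda>\<omega>. (Y \<omega>)\<^sup>2)"
  shows "expectation Y \<le> sqrt (expectation (\<lambda>\<omega>. (Y \<omega>)\<^sup>2))"
  using variance_eq[OF assms] variance_positive[of Y] by (intro real_le_rsqrt) simp

lemma (in prob_space) indep_var_of_indep_vars:
  assumes ind: "indep_vars M' W I" and ij: "i \<in> I" "j \<in> I" "i \<noteq> j"
  shows "indep_var (M' i) (W i) (M' j) (W j)"
proof -
  have "indep_var (M' i) ((\<lambda>f. f i) \<circ> (\<lambda>\<omega>. restrict (\<lambda>k. W k \<omega>) {i}))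
                  (M' j) ((\<lambda>f. f j) \<circ> (\<lambda>\<omega>. restrict (\<lambda>k. W k \<omega>) {j}))"
    using ij by (intro indep_var_compose[OF indep_var_restrict[OF ind]] measurable_component_singleton) auto
  then show ?thesis by (simp add: o_def)
qed

text \<open>
  Expanding the square gives the products \<open>W i * cnj (W j)\<close>; by independence and centring those off
  the diagonal integrate to zero.
\<close>

lemma (in prob_space) indep_centered_second_moment:
  fixes W :: "'i \<Rightarrow> 'a \<Rightarrow> complex"
  assumes I: "finite I" and ind: "indep_vars (\<lambda>_. borel) W I"
    and sq: "\<And>i. i \<in> I \<Longrightarrow> integrable M (\<lambda>\<omega>. (norm (W i \<omega>))\<^sup>2)"
    and mean: "\<And>i. i \<in> I \<Longrightarrow> expectation (W i) = 0"
  shows "integrable M (\<lambda>\<omega>. (norm (\<Sum>i\<in>I. W i \<omega>))\<^sup>2)"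
    and "expectation (\<lambda>\<omega>. (norm (\<Sum>i\<in>I. W i \<omega>))\<^sup>2) = (\<Sum>i\<in>I. expectation (\<lambda>\<omega>. (norm (W i \<omega>))\<^sup>2))"
proof -
  have m: "W i \<in> borel_measurable M" if "i \<in> I" for i
    using ind that by (auto simp: indep_vars_def)
  have int: "integrable M (W i)" if "i \<in> I" for i
  proof (rule integrable_norm_cancel[OF _ m[OF that]])
    show "integrable M (\<lambda>\<omega>. norm (W i \<omega>))"
      using m[OF that] by (intro square_integrable_imp_integrable[OF _ sq[OF that]]) measurable
  qed
  have prod: "integrable M (\<lambda>\<omega>. W i \<omega> * cnj (W j \<omega>))
     \<and> expectation (\<lambda>\<omega>. W i \<omega> * cnj (W j \<omega>)) = (if i = j then of_real (expectation (\<lambda>\<omega>. (norm (W i \<omega>))\<^sup>2)) else 0)"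
    if ij: "i \<in> I" "j \<in> I" for i j
  proof (cases "i = j")
    case True
    have "W i \<omega> * cnj (W i \<omega>) = of_real ((norm (W i \<omega>))\<^sup>2)" for \<omega>
      by (simp only: complex_norm_square)
    then show ?thesis using True sq[OF ij(1)]
      by (simp only: integral_complex_of_real complex_of_real_integrable_eq if_True simp_thms)
  next
    case False
    have "indep_var borel (W i) borel (W j)"
      by (rule indep_var_of_indep_vars[OF ind ij False])
    then have iv: "indep_var borel (W i) borel (\<lambda>\<omega>. cnj (W j \<omega>))"
      using indep_var_compose[of borel "W i" borel "W j" "\<lambda>x. x" borel cnj borel]
      by (simp add: o_def borel_measurable_continuous_onI continuous_intros)
    have ci: "integrable M (\<lambda>\<omega>. cnj (W j \<omega>))"
      using int[OF ij(2)] by simp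
    have "expectation (\<lambda>\<omega>. W i \<omega> * cnj (W j \<omega>)) = expectation (W i) * expectation (\<lambda>\<omega>. cnj (W j \<omega>))"
      by (rule indep_var_lebesgue_integral[OF iv int[OF ij(1)] ci])
    then show ?thesis using indep_var_integrable[OF iv int[OF ij(1)] ci] False mean[OF ij(1)] by simp
  qed
  have expand: "complex_of_real ((norm (\<Sum>i\<in>I. W i \<omega>))\<^sup>2) = (\<Sum>i\<in>I. \<Sum>j\<in>I. W i \<omega> * cnj (W j \<omega>))" for \<omega>
    by (simp only: complex_norm_square cnj_sum sum_product)
  have "integrable M (\<lambda>\<omega>. complex_of_real ((norm (\<Sum>i\<in>I. W i \<omega>))\<^sup>2))"
    unfolding expand using prod by (intro Bochner_Integration.integrable_sum) blast
  then show "integrable M (\<lambda>\<omega>. (norm (\<Sum>i\<in>I. W i \<omega>))\<^sup>2)"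
    by (simp only: complex_of_real_integrable_eq)
  have "complex_of_real (expectation (\<lambda>\<omega>. (norm (\<Sum>i\<in>I. W i \<omega>))\<^sup>2))
      = expectation (\<lambda>\<omega>. \<Sum>i\<in>I. \<Sum>j\<in>I. W i \<omega> * cnj (W j \<omega>))"
    unfolding expand[symmetric] by (rule integral_complex_of_real[symmetric])
  also have "\<dots> = (\<Sum>i\<in>I. expectation (\<lambda>\<omega>. \<Sum>j\<in>I. W i \<omega> * cnj (W j \<omega>)))"
    using prod by (intro Bochner_Integration.integral_sum Bochner_Integration.integrable_sum) blast
  also have "\<dots> = (\<Sum>i\<in>I. \<Sum>j\<in>I. expectation (\<lambda>\<omega>. W i \<omega> * cnj (W j \<omega>)))"
    using prod by (intro sum.cong refl Bochner_Integration.integral_sum) blast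
  also have "\<dots> = (\<Sum>i\<in>I. of_real (expectation (\<lambda>\<omega>. (norm (W i \<omega>))\<^sup>2)))"
    using prod I by (intro sum.cong refl) (simp add: sum.delta)
  finally show "expectation (\<lambda>\<omega>. (norm (\<Sum>i\<in>I. W i \<omega>))\<^sup>2) = (\<Sum>i\<in>I. expectation (\<lambda>\<omega>. (norm (W i \<omega>))\<^sup>2))"
    by (simp only: of_real_sum[symmetric] of_real_eq_iff)
qed

lemma (in prob_space) transfer_law:
  fixes h :: "real \<Rightarrow> 'b::{banach,second_countable_topology}"
  assumes "Y \<in> borel_measurable M" "distr M borel Y = D" "h \<in> borel_measurable borel"
  shows "integrable M (\<lambda>\<omega>. h (Y \<omega>)) = integrable D h"
    and "expectation (\<lambda>\<omega>. h (Y \<omega>)) = (LINT x|D. h x)"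
  unfolding assms(2)[symmetric]
  by (subst integrable_distr_eq; use assms in simp) (subst integral_distr; use assms in simp)

lemma (in prob_space) iid_sum_L1_le_sqrt_second_moment:
  fixes g :: "real \<Rightarrow> complex" and X :: "'i \<Rightarrow> 'a \<Rightarrow> real"
  assumes I: "finite I" and ind: "indep_vars (\<lambda>_. borel) X I"
    and D: "real_distribution D" and law: "\<And>i. i \<in> I \<Longrightarrow> distr M borel (X i) = D"
    and g: "g \<in> borel_measurable borel" and sq: "integrable D (\<lambda>x. (norm (g x))\<^sup>2)"
  shows "integrable D g"
    and "integrable M (\<lambda>\<omega>. norm ((\<Sum>i\<in>I. g (X i \<omega>)) - card I * (LINT x|D. g x)))"
    and "expectation (\<lambda>\<omega>. norm ((\<Sum>i\<in>I. g (X i \<omega>)) - card I * (LINT x|D. g x)))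
      \<le> sqrt (card I * (LINT x|D. (norm (g x))\<^sup>2))"
proof -
  interpret D: real_distribution D by (rule D)
  have D1: "measure D UNIV = 1" using D.prob_space by simp
  have gD: "g \<in> borel_measurable D" using g by simp
  show gi: "integrable D g"
  proof (rule integrable_norm_cancel[OF _ gD])
    show "integrable D (\<lambda>x. norm (g x))"
      by (rule D.square_integrable_imp_integrable[OF measurable_compose[OF gD borel_measurable_norm] sq])
  qed
  define \<mu> where "\<mu> = (LINT x|D. g x)"
  define W where "W i \<omega> = g (X i \<omega>) - \<mu>" for i \<omega>
  have X: "X i \<in> borel_measurable M" if "i \<in> I" for i
    using ind that by (auto simp: indep_vars_def)
  have gm: "(\<lambda>x. g x - \<mu>) \<in> borel_measurable borel" using g by measurable
  define R where "R x = Re (g x * cnj \<mu>)" for x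
  \<comment> \<open>centring can only decrease the second moment; this is the expansion that shows it\<close>
  have nsq: "(norm (g x - \<mu>))\<^sup>2 = (norm (g x))\<^sup>2 + (norm \<mu>)\<^sup>2 - 2 * R x" for x
    unfolding cmod_power2 R_def by (simp add: power2_eq_square algebra_simps)
  have ri: "integrable D R"
    unfolding R_def[abs_def] using gi by (intro integrable_Re integrable_mult_left)
  have rv: "(LINT x|D. R x) = (norm \<mu>)\<^sup>2"
  proof -
    have "(LINT x|D. Re (g x * cnj \<mu>)) = Re (LINT x|D. g x * cnj \<mu>)"
      using gi by (intro integral_Re integrable_mult_left)
    also have "(LINT x|D. g x * cnj \<mu>) = of_real ((norm \<mu>)\<^sup>2)"
      by (simp only: integral_mult_left_zero \<mu>_def[symmetric] complex_norm_square)
    finally show ?thesis by (simp only: R_def Re_complex_of_real)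
  qed
  have Wsq: "integrable D (\<lambda>x. (norm (g x - \<mu>))\<^sup>2)"
    unfolding nsq using sq ri by (intro Bochner_Integration.integrable_diff Bochner_Integration.integrable_add integrable_mult_right) simp_all
  have "(LINT x|D. (norm (g x - \<mu>))\<^sup>2) = (LINT x|D. (norm (g x))\<^sup>2) + (norm \<mu>)\<^sup>2 - 2 * (norm \<mu>)\<^sup>2"
    unfolding nsq using sq ri by (simp add: rv D1)
  then have Wle: "(LINT x|D. (norm (g x - \<mu>))\<^sup>2) \<le> (LINT x|D. (norm (g x))\<^sup>2)"
    by simp
  have "indep_vars (\<lambda>_. borel) W I"
    unfolding W_def using indep_vars_compose2[OF ind, of "\<lambda>_ x. g x - \<mu>" "\<lambda>_. borel"] gm by simp
  moreover have "integrable M (\<lambda>\<omega>. (norm (W i \<omega>))\<^sup>2)"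
    "expectation (\<lambda>\<omega>. (norm (W i \<omega>))\<^sup>2) = (LINT x|D. (norm (g x - \<mu>))\<^sup>2)" if "i \<in> I" for i
    unfolding W_def using transfer_law[OF X law, OF that that, of "\<lambda>x. (norm (g x - \<mu>))\<^sup>2"] Wsq gm
    by simp_all
  moreover have "expectation (W i) = 0" if "i \<in> I" for i
    unfolding W_def using transfer_law(2)[OF X law, OF that that, of "\<lambda>x. g x - \<mu>"] gi gm
    by (simp add: \<mu>_def[symmetric] D1)
  ultimately have S: "integrable M (\<lambda>\<omega>. (norm (\<Sum>i\<in>I. W i \<omega>))\<^sup>2)"
    "expectation (\<lambda>\<omega>. (norm (\<Sum>i\<in>I. W i \<omega>))\<^sup>2) = card I * (LINT x|D. (norm (g x - \<mu>))\<^sup>2)"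
    using indep_centered_second_moment[OF I, of W] by simp_all
  have eq: "(\<Sum>i\<in>I. g (X i \<omega>)) - card I * (LINT x|D. g x) = (\<Sum>i\<in>I. W i \<omega>)" for \<omega>
    by (simp add: W_def sum_subtractf \<mu>_def)
  have Wm: "(\<lambda>\<omega>. norm (\<Sum>i\<in>I. W i \<omega>)) \<in> borel_measurable M"
    unfolding W_def using X gm by (intro measurable_compose[OF _ borel_measurable_norm] borel_measurable_sum) (rule measurable_compose)
  show i: "integrable M (\<lambda>\<omega>. norm ((\<Sum>i\<in>I. g (X i \<omega>)) - card I * (LINT x|D. g x)))"
    unfolding eq by (rule square_integrable_imp_integrable[OF Wm S(1)])
  have "expectation (\<lambda>\<omega>. norm (\<Sum>i\<in>I. W i \<omega>)) \<le> sqrt (card I * (LINT x|D. (norm (g x - \<mu>))\<^sup>2))"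
    using expectation_le_sqrt_second_moment[OF i[unfolded eq] S(1)] unfolding S(2) .
  also have "\<dots> \<le> sqrt (card I * (LINT x|D. (norm (g x))\<^sup>2))"
    using Wle by (intro real_sqrt_le_mono mult_left_mono) simp_all
  finally show "expectation (\<lambda>\<omega>. norm ((\<Sum>i\<in>I. g (X i \<omega>)) - card I * (LINT x|D. g x)))
      \<le> sqrt (card I * (LINT x|D. (norm (g x))\<^sup>2))"
    unfolding eq .
qed

text \<open>
  A sum of independent copies of a heavy-tailed variable may have a useless variance although its
  typical fluctuation is small.  The part \<open>g\<close> of the summand is controlled through its variance, and
  the part \<open>h\<close>, which carries the large values, only through the triangle inequality.
\<close>

lemma (in prob_space) iid_sum_L1_truncation:
  fixes g h :: "real \<Rightarrow> complex" and X :: "'i \<Rightarrow> 'a \<Rightarrow> real"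
  assumes I: "finite I" and ind: "indep_vars (\<lambda>_. borel) X I"
    and D: "real_distribution D" and law: "\<And>i. i \<in> I \<Longrightarrow> distr M borel (X i) = D"
    and g: "g \<in> borel_measurable borel" and sq: "integrable D (\<lambda>x. (norm (g x))\<^sup>2)"
    and h: "h \<in> borel_measurable borel" and hi: "integrable D h"
  shows "integrable M (\<lambda>\<omega>. norm ((\<Sum>i\<in>I. g (X i \<omega>) + h (X i \<omega>)) - card I * (LINT x|D. g x + h x)))"
    and "expectation (\<lambda>\<omega>. norm ((\<Sum>i\<in>I. g (X i \<omega>) + h (X i \<omega>)) - card I * (LINT x|D. g x + h x)))
      \<le> sqrt (card I * (LINT x|D. (norm (g x))\<^sup>2)) + 2 * card I * (LINT x|D. norm (h x))"
proof -
  note L2 = iid_sum_L1_le_sqrt_second_moment[OF I ind D law g sq]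
  have X: "X i \<in> borel_measurable M" if "i \<in> I" for i
    using ind that by (auto simp: indep_vars_def)
  let ?A = "\<lambda>\<omega>. (\<Sum>i\<in>I. g (X i \<omega>)) - card I * (LINT x|D. g x)"
  let ?B = "\<lambda>\<omega>. (\<Sum>i\<in>I. h (X i \<omega>)) - card I * (LINT x|D. h x)"
  have eq: "(\<Sum>i\<in>I. g (X i \<omega>) + h (X i \<omega>)) - card I * (LINT x|D. g x + h x) = ?A \<omega> + ?B \<omega>" for \<omega>
    using L2(1) hi by (simp add: sum.distrib algebra_simps)
  have hX: "integrable M (\<lambda>\<omega>. norm (h (X i \<omega>)))" 
    "expectation (\<lambda>\<omega>. norm (h (X i \<omega>))) = (LINT x|D. norm (h x))" if "i \<in> I" for i
    using transfer_law[OF X law, OF that that, of "\<lambda>x. norm (h x)"] h hi by simp_all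
  define T where "T \<omega> = (\<Sum>i\<in>I. norm (h (X i \<omega>))) + card I * (LINT x|D. norm (h x))" for \<omega>
  have Ti: "integrable M T" unfolding T_def using hX by (intro Bochner_Integration.integrable_add) auto
  have TE: "expectation T = 2 * card I * (LINT x|D. norm (h x))"
    unfolding T_def using hX by (simp add: prob_space)
  have le: "norm (?A \<omega> + ?B \<omega>) \<le> norm (?A \<omega>) + T \<omega>" for \<omega>
  proof -
    have "norm (?B \<omega>) \<le> norm (\<Sum>i\<in>I. h (X i \<omega>)) + norm (card I * (LINT x|D. h x))"
      by (rule norm_triangle_ineq4)
    also have "\<dots> \<le> T \<omega>" unfolding T_def
      by (intro add_mono norm_sum) (simp add: norm_mult mult_left_mono)
    finally show ?thesis using norm_triangle_ineq[of "?A \<omega>" "?B \<omega>"] by linarith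
  qed
  have ABm: "(\<lambda>\<omega>. ?A \<omega> + ?B \<omega>) \<in> borel_measurable M"
    using X g h by (intro borel_measurable_add borel_measurable_diff borel_measurable_sum borel_measurable_const)
     (auto intro: measurable_compose)
  have iAT: "integrable M (\<lambda>\<omega>. norm (?A \<omega>) + T \<omega>)" using L2(2) Ti by simp
  have "integrable M (\<lambda>\<omega>. ?A \<omega> + ?B \<omega>)"
    by (intro Bochner_Integration.integrable_bound[OF iAT ABm] AE_I2)
      (simp only: real_norm_def, rule order_trans[OF le abs_ge_self])
  then show i: "integrable M (\<lambda>\<omega>. norm ((\<Sum>i\<in>I. g (X i \<omega>) + h (X i \<omega>)) - card I * (LINT x|D. g x + h x)))"
    unfolding eq by (rule integrable_norm)
  have "expectation (\<lambda>\<omega>. norm (?A \<omega> + ?B \<omega>)) \<le> expectation (\<lambda>\<omega>. norm (?A \<omega>) + T \<omega>)"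
    using i[unfolded eq] iAT le by (rule integral_mono)
  also have "\<dots> = expectation (\<lambda>\<omega>. norm (?A \<omega>)) + 2 * card I * (LINT x|D. norm (h x))"
    using L2(2) Ti TE by simp
  also have "\<dots> \<le> sqrt (card I * (LINT x|D. (norm (g x))\<^sup>2)) + 2 * card I * (LINT x|D. norm (h x))"
    using L2(3) by simp
  finally show "expectation (\<lambda>\<omega>. norm ((\<Sum>i\<in>I. g (X i \<omega>) + h (X i \<omega>)) - card I * (LINT x|D. g x + h x)))
      \<le> sqrt (card I * (LINT x|D. (norm (g x))\<^sup>2)) + 2 * card I * (LINT x|D. norm (h x))"
    unfolding eq .
qed

section \<open>Mean deviation of the partition function\<close>

text \<open>
  The expectation of the partition function, by \<open>E exp (a X) = exp (a^2 / 2)\<close>.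
\<close>

definition rem_mean :: "nat \<Rightarrow> complex \<Rightarrow> complex" where
  "rem_mean N \<beta> = of_nat N * exp (\<beta>\<^sup>2 * of_real (ln (real N)) / 2)"

text \<open>
  For \<open>\<bar>Re \<beta>\<bar> \<le> sqrt 2\<close> the partition function deviates in \<open>L1\<close>, relative to its mean, by at most
  a constant times \<open>N\<close> to the power minus this rate.  The first summand is what the variance gives.  The second is the gain from truncation:
  if \<open>sqrt 2 * \<bar>Re \<beta>\<bar> > 1\<close>, the variance is dominated by values of the Gaussians that
  exceed the maximum \<open>sqrt (2 * ln N)\<close> of a typical sample.  With both summands the rate is
  \<open>((sqrt 2 - \<bar>Re \<beta>\<bar>)\<^sup>2 - (Im \<beta>)\<^sup>2) / 2\<close> there, which for
  \<open>\<bar>Re \<beta>\<bar> < sqrt 2\<close> is positive exactly when \<open>\<bar>Re \<beta>\<bar> + \<bar>Im \<beta>\<bar> < sqrt 2\<close>.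
  This form, unlike a case distinction, is visibly continuous in \<open>\<beta>\<close>.
\<close>

definition rem_rate :: "complex \<Rightarrow> real" where
  "rem_rate \<beta> = (1 - (norm \<beta>)\<^sup>2) / 2 + (max 0 (sqrt 2 * \<bar>Re \<beta>\<bar> - 1))\<^sup>2 / 2"

lemma norm_rem_mean:
  assumes "N \<ge> 1"
  shows "norm (rem_mean N \<beta>) = exp (ln (real N) * (1 + ((Re \<beta>)\<^sup>2 - (Im \<beta>)\<^sup>2) / 2))"
proof -
  have "Re (\<beta>\<^sup>2 * of_real (ln (real N)) / 2) = ln (real N) * (((Re \<beta>)\<^sup>2 - (Im \<beta>)\<^sup>2) / 2)"
    by (simp add: power2_eq_square)
  then show ?thesis using assms
    by (simp add: rem_mean_def norm_mult distrib_left exp_add del: Re_divide_numeral)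
qed

definition rem_weight :: "nat \<Rightarrow> complex \<Rightarrow> real \<Rightarrow> complex" where
  "rem_weight N \<beta> x = exp (\<beta> * of_real (sqrt (ln (real N)) * x))"

lemma rem_weight_first_moment:
  assumes N: "N \<ge> 1"
  shows "rem_weight N \<beta> \<in> borel_measurable borel"
    and "integrable std_normal_distribution (rem_weight N \<beta>)"
    and "(LINT x|std_normal_distribution. rem_weight N \<beta> x) = exp (\<beta>\<^sup>2 * of_real (ln (real N)) / 2)"
    and "norm (rem_weight N \<beta> x) = exp (Re \<beta> * (sqrt (ln (real N)) * x))"
proof -
  have e: "rem_weight N \<beta> = (\<lambda>x. exp ((\<beta> * of_real (sqrt (ln (real N)))) * of_real x))"
    by (simp add: rem_weight_def mult.assoc fun_eq_iff)
  show "rem_weight N \<beta> \<in> borel_measurable borel"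
    unfolding e by (intro borel_measurable_continuous_onI continuous_intros)
  show "integrable std_normal_distribution (rem_weight N \<beta>)"
    unfolding e by (rule complex_mgf_std_normal)
  have sq: "(complex_of_real (sqrt (ln (real N))))\<^sup>2 = of_real (ln (real N))"
    using N by (simp only: of_real_power[symmetric]) simp
  show "(LINT x|std_normal_distribution. rem_weight N \<beta> x) = exp (\<beta>\<^sup>2 * of_real (ln (real N)) / 2)"
    unfolding e complex_mgf_std_normal(2) power_mult_distrib sq ..
  show "norm (rem_weight N \<beta> x) = exp (Re \<beta> * (sqrt (ln (real N)) * x))"
    by (simp add: rem_weight_def)
qed

lemma rem_weight_second_moment:
  assumes N: "N \<ge> 1"
  shows "integrable std_normal_distribution (\<lambda>x. (norm (rem_weight N \<beta> x))\<^sup>2)"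
    and "(LINT x|std_normal_distribution. (norm (rem_weight N \<beta> x))\<^sup>2) = exp (ln (real N) * (2 * (Re \<beta>)\<^sup>2))"
proof -
  have e: "(norm (rem_weight N \<beta> x))\<^sup>2 = exp ((2 * Re \<beta> * sqrt (ln (real N))) * x)" for x
    unfolding rem_weight_first_moment(4)[OF N] by (simp add: exp_double[symmetric] mult_ac)
  have "(2 * Re \<beta> * sqrt (ln (real N)))\<^sup>2 / 2 = ln (real N) * (2 * (Re \<beta>)\<^sup>2)"
    using N by (simp add: power_mult_distrib)
  then show "integrable std_normal_distribution (\<lambda>x. (norm (rem_weight N \<beta> x))\<^sup>2)"
    "(LINT x|std_normal_distribution. (norm (rem_weight N \<beta> x))\<^sup>2) = exp (ln (real N) * (2 * (Re \<beta>)\<^sup>2))"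
    unfolding e using mgf_std_normal[of "2 * Re \<beta> * sqrt (ln (real N))"] by simp_all
qed

text \<open>
  The cut is made at \<open>t = sqrt 2 * sqrt (ln N)\<close>, which is about the size of the maximum of \<open>N\<close>
  standard Gaussians, on the side where \<open>\<bar>exp (\<beta> ...)\<bar>\<close> is large.  Both bounds are exponential
  Chebyshev estimates with tilt \<open>t\<close>.  By the two hypotheses on \<open>Re \<beta>\<close>, the squared modulus of the
  weight grows at least as fast as \<open>exp (t * x)\<close> and the modulus at most as fast (for \<open>Re \<beta> > 0\<close>; with
  \<open>-x\<close> in place of \<open>x\<close> otherwise).  Hence the quotient
  with \<open>exp (t * x)\<close> is largest at the cut both for the squared modulus over the low values and for the
  modulus over the high ones.
\<close>

lemma rem_weight_truncation:
  assumes N: "N \<ge> 1" and lo: "1 \<le> sqrt 2 * \<bar>Re \<beta>\<bar>" and hi: "\<bar>Re \<beta>\<bar> \<le> sqrt 2"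
  defines "low \<equiv> {x. sgn (Re \<beta>) * x \<le> sqrt 2 * sqrt (ln (real N))}"
  shows "(LINT x|std_normal_distribution. (norm (indicator low x * rem_weight N \<beta> x))\<^sup>2)
           \<le> exp (ln (real N) * (2 * sqrt 2 * \<bar>Re \<beta>\<bar> - 1))"
    and "(LINT x|std_normal_distribution. norm (indicator (- low) x * rem_weight N \<beta> x))
           \<le> exp (ln (real N) * (sqrt 2 * \<bar>Re \<beta>\<bar> - 1))"
proof -
  define s where "s = sqrt (ln (real N))"
  define \<sigma> where "\<sigma> = Re \<beta>"
  \<comment> \<open>the tilt; its moment generating function has the value \<open>N\<close>\<close>
  define u where "u = sqrt 2 * s * sgn \<sigma>"
  have s: "s \<ge> 0" "s * s = ln (real N)" using N by (simp_all add: s_def)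
  have \<sigma>: "\<sigma> \<noteq> 0" using lo by (auto simp: \<sigma>_def)
  have \<sigma>x: "\<sigma> * (s * x) = \<bar>\<sigma>\<bar> * s * (sgn \<sigma> * x)" for x
    using \<sigma> by (simp add: sgn_real_def)
  have lo': "2 * \<bar>\<sigma>\<bar> - sqrt 2 \<ge> 0"
  proof -
    have "sqrt 2 * 1 \<le> sqrt 2 * (sqrt 2 * \<bar>\<sigma>\<bar>)" using lo unfolding \<sigma>_def by (intro mult_left_mono) auto
    then show ?thesis by (simp add: mult.assoc[symmetric])
  qed
  have u2: "u\<^sup>2 / 2 = ln (real N)"
    using \<sigma> by (simp add: u_def power2_eq_square s(2)[symmetric] sgn_real_def)
  have low: "low = {x. sgn \<sigma> * x \<le> sqrt 2 * s}" by (simp add: low_def \<sigma>_def s_def)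
  have [measurable]: "low \<in> sets borel" unfolding low by measurable
  have wn: "norm (rem_weight N \<beta> x) = exp (\<bar>\<sigma>\<bar> * s * (sgn \<sigma> * x))" for x
    unfolding rem_weight_first_moment(4)[OF N] \<sigma>x[symmetric] by (simp add: \<sigma>_def s_def)
  have ux: "u * x = sqrt 2 * s * (sgn \<sigma> * x)" for x by (simp add: u_def)
  have "(norm (indicator low x * rem_weight N \<beta> x))\<^sup>2 \<le> exp (ln (real N) * (2 * sqrt 2 * \<bar>\<sigma>\<bar> - 2)) * exp (u * x)" for x
  proof (cases "x \<in> low")
    case True
    let ?y = "sgn \<sigma> * x"
    have "(2 * \<bar>\<sigma>\<bar> - sqrt 2) * s * ?y \<le> (2 * \<bar>\<sigma>\<bar> - sqrt 2) * s * (sqrt 2 * s)"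
      using True lo' s(1) by (intro mult_left_mono) (auto simp: low)
    also have "\<dots> = ln (real N) * (2 * sqrt 2 * \<bar>\<sigma>\<bar> - 2)"
      unfolding s(2)[symmetric] by (simp add: algebra_simps)
    finally have "2 * (\<bar>\<sigma>\<bar> * s * ?y) \<le> ln (real N) * (2 * sqrt 2 * \<bar>\<sigma>\<bar> - 2) + u * x"
      unfolding ux by (simp add: algebra_simps)
    then show ?thesis using True
      by (simp add: wn exp_add[symmetric] exp_double[symmetric])
  qed simp
  then have "(LINT x|std_normal_distribution. (norm (indicator low x * rem_weight N \<beta> x))\<^sup>2)
      \<le> (LINT x|std_normal_distribution. exp (ln (real N) * (2 * sqrt 2 * \<bar>\<sigma>\<bar> - 2)) * exp (u * x))"
    by (intro integral_mono_AE' AE_I2 integrable_mult_right mgf_std_normal) auto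
  also have "\<dots> = exp (ln (real N) * (2 * sqrt 2 * \<bar>\<sigma>\<bar> - 1))"
    by (simp only: integral_mult_right_zero mgf_std_normal(2) u2) (simp add: exp_add[symmetric] algebra_simps)
  finally show "(LINT x|std_normal_distribution. (norm (indicator low x * rem_weight N \<beta> x))\<^sup>2)
           \<le> exp (ln (real N) * (2 * sqrt 2 * \<bar>Re \<beta>\<bar> - 1))"
    unfolding \<sigma>_def .
  have "norm (indicator (- low) x * rem_weight N \<beta> x) \<le> exp (ln (real N) * (sqrt 2 * \<bar>\<sigma>\<bar> - 2)) * exp (u * x)" for x
  proof (cases "x \<in> low")
    case False
    let ?y = "sgn \<sigma> * x"
    have "(sqrt 2 - \<bar>\<sigma>\<bar>) * s * (sqrt 2 * s) \<le> (sqrt 2 - \<bar>\<sigma>\<bar>) * s * ?y"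
      using False hi s(1) by (intro mult_left_mono) (auto simp: low \<sigma>_def)
    moreover have "(sqrt 2 - \<bar>\<sigma>\<bar>) * s * (sqrt 2 * s) = - (ln (real N) * (sqrt 2 * \<bar>\<sigma>\<bar> - 2))"
      unfolding s(2)[symmetric] by (simp add: algebra_simps)
    ultimately have "\<bar>\<sigma>\<bar> * s * ?y \<le> ln (real N) * (sqrt 2 * \<bar>\<sigma>\<bar> - 2) + u * x"
      unfolding ux by (simp add: algebra_simps)
    then show ?thesis using False
      by (simp add: wn exp_add[symmetric])
  qed simp
  then have "(LINT x|std_normal_distribution. norm (indicator (- low) x * rem_weight N \<beta> x))
      \<le> (LINT x|std_normal_distribution. exp (ln (real N) * (sqrt 2 * \<bar>\<sigma>\<bar> - 2)) * exp (u * x))"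
    by (intro integral_mono_AE' AE_I2 integrable_mult_right mgf_std_normal) auto
  also have "\<dots> = exp (ln (real N) * (sqrt 2 * \<bar>\<sigma>\<bar> - 1))"
    by (simp only: integral_mult_right_zero mgf_std_normal(2) u2) (simp add: exp_add[symmetric] algebra_simps)
  finally show "(LINT x|std_normal_distribution. norm (indicator (- low) x * rem_weight N \<beta> x))
           \<le> exp (ln (real N) * (sqrt 2 * \<bar>Re \<beta>\<bar> - 1))"
    unfolding \<sigma>_def .
qed

text \<open>
  For \<open>sqrt 2 * \<bar>Re \<beta>\<bar> \<le> 1\<close> the plain variance bound suffices; otherwise the summand is
  cut as above.  The variance of the low part and the mean of the high part then contribute the same
  order \<open>exp (sqrt 2 * \<bar>Re \<beta>\<bar> * ln N)\<close>, once and twice respectively, whence the constant \<open>3\<close>.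
\<close>

lemma (in prob_space) rem_L1_deviation:
  fixes X :: "nat \<Rightarrow> 'a \<Rightarrow> real"
  assumes ind: "indep_vars (\<lambda>_. borel) X {1..}"
    and law: "\<And>k. k \<ge> 1 \<Longrightarrow> distr M borel (X k) = std_normal_distribution"
    and N: "N \<ge> 1" and \<beta>: "\<bar>Re \<beta>\<bar> \<le> sqrt 2"
  shows "integrable M (\<lambda>\<omega>. norm (rem_partition X N \<beta> \<omega> / rem_mean N \<beta> - 1))"
    and "expectation (\<lambda>\<omega>. norm (rem_partition X N \<beta> \<omega> / rem_mean N \<beta> - 1)) \<le> 3 * real N powr (- rem_rate \<beta>)"
proof -
  let ?D = "std_normal_distribution" and ?n = "ln (real N)"
  define \<sigma> \<tau> where "\<sigma> = Re \<beta>" and "\<tau> = Im \<beta>"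
  let ?w = "rem_weight N \<beta>"
  note W = rem_weight_first_moment[OF N, of \<beta>]
  note W2 = rem_weight_second_moment[OF N, of \<beta>]
  have N': "exp ?n = real N" using N by simp
  have NE: "N * exp a = exp (?n + a)" for a by (simp add: exp_add N')
  have ind': "indep_vars (\<lambda>_. borel) X {1..N}"
    using indep_vars_subset[OF ind] by auto
  have law': "distr M borel (X k) = ?D" if "k \<in> {1..N}" for k using law that by simp
  let ?\<Delta> = "\<lambda>\<omega>. norm (rem_partition X N \<beta> \<omega> - rem_mean N \<beta>)"
  have m: "rem_mean N \<beta> = card {1..N} * (LINT x|?D. ?w x)"
    by (simp add: rem_mean_def W(3))
  have Z: "rem_partition X N \<beta> \<omega> = (\<Sum>k\<in>{1..N}. ?w (X k \<omega>))" for \<omega>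
    by (simp add: rem_partition_def rem_weight_def)
  have nm: "norm (rem_mean N \<beta>) = exp (?n * (1 + (\<sigma>\<^sup>2 - \<tau>\<^sup>2) / 2))"
    unfolding \<sigma>_def \<tau>_def by (rule norm_rem_mean[OF N])
  then have m0: "rem_mean N \<beta> \<noteq> 0" by auto
  have nb: "(norm \<beta>)\<^sup>2 = \<sigma>\<^sup>2 + \<tau>\<^sup>2" by (simp add: \<sigma>_def \<tau>_def cmod_power2)
  note L2 = iid_sum_L1_le_sqrt_second_moment[OF _ ind' real_dist_normal_dist law' W(1) W2(1), folded Z m]
  have q: "norm (rem_partition X N \<beta> \<omega> / rem_mean N \<beta> - 1) = ?\<Delta> \<omega> / norm (rem_mean N \<beta>)" for \<omega>
    using m0 by (simp add: norm_divide[symmetric] diff_divide_distrib)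
  show "integrable M (\<lambda>\<omega>. norm (rem_partition X N \<beta> \<omega> / rem_mean N \<beta> - 1))"
    unfolding q using L2(2) by simp
  have "expectation ?\<Delta> \<le> 3 * exp (?n * (1 + (\<sigma>\<^sup>2 - \<tau>\<^sup>2) / 2 - rem_rate \<beta>))"
  proof (cases "sqrt 2 * \<bar>\<sigma>\<bar> \<le> 1")
    case True
    then have r: "rem_rate \<beta> = (1 - (\<sigma>\<^sup>2 + \<tau>\<^sup>2)) / 2"
      unfolding rem_rate_def nb using \<sigma>_def by simp
    have "expectation ?\<Delta> \<le> sqrt (N * exp (?n * (2 * \<sigma>\<^sup>2)))"
      using L2(3) by (simp add: W2(2) \<sigma>_def)
    also have "N * exp (?n * (2 * \<sigma>\<^sup>2)) = (exp (?n * (1/2 + \<sigma>\<^sup>2)))\<^sup>2"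
      unfolding NE by (simp add: exp_double[symmetric] algebra_simps)
    also have "sqrt \<dots> = exp (?n * (1 + (\<sigma>\<^sup>2 - \<tau>\<^sup>2) / 2 - rem_rate \<beta>))"
      unfolding r by (simp add: field_simps)
    also have "\<dots> \<le> 3 * \<dots>" by simp
    finally show ?thesis .
  next
    case False
    define low where "low = {x. sgn \<sigma> * x \<le> sqrt 2 * sqrt ?n}"
    have [measurable]: "low \<in> sets borel" unfolding low_def by measurable
    have [measurable]: "?w \<in> borel_measurable borel" by (rule W)
    note T = rem_weight_truncation[OF N _ \<beta>, folded \<sigma>_def, folded low_def]
    have r: "rem_rate \<beta> = 1 + (\<sigma>\<^sup>2 - \<tau>\<^sup>2) / 2 - sqrt 2 * \<bar>\<sigma>\<bar>"
      using False unfolding rem_rate_def nb \<sigma>_def[symmetric]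
      by (simp add: max_def power2_diff power_mult_distrib field_simps)
    let ?g = "\<lambda>x. indicator low x * ?w x" and ?h = "\<lambda>x. indicator (- low) x * ?w x"
    have split: "?w x = ?g x + ?h x" for x by (simp add: indicator_def)
    have gsq: "integrable ?D (\<lambda>x. (norm (?g x))\<^sup>2)"
      by (rule Bochner_Integration.integrable_bound[OF W2(1)]) (auto simp: indicator_def)
    have hi: "integrable ?D ?h"
      by (rule Bochner_Integration.integrable_bound[OF W(2)]) (auto simp: indicator_def)
    have "expectation ?\<Delta> \<le> sqrt (N * (LINT x|?D. (norm (?g x))\<^sup>2)) + 2 * N * (LINT x|?D. norm (?h x))"
      using iid_sum_L1_truncation(2)[OF _ ind' real_dist_normal_dist law' _ gsq _ hi, folded split, folded Z m] by simp
    also have "\<dots> \<le> sqrt (N * exp (?n * (2 * sqrt 2 * \<bar>\<sigma>\<bar> - 1))) + 2 * N * exp (?n * (sqrt 2 * \<bar>\<sigma>\<bar> - 1))"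
      using T False by (intro add_mono real_sqrt_le_mono mult_left_mono) auto
    also have "N * exp (?n * (2 * sqrt 2 * \<bar>\<sigma>\<bar> - 1)) = (exp (?n * (sqrt 2 * \<bar>\<sigma>\<bar>)))\<^sup>2"
      unfolding NE by (simp add: exp_double[symmetric] algebra_simps)
    also have "2 * N * exp (?n * (sqrt 2 * \<bar>\<sigma>\<bar> - 1)) = 2 * exp (?n * (sqrt 2 * \<bar>\<sigma>\<bar>))"
      using NE[of "?n * (sqrt 2 * \<bar>\<sigma>\<bar> - 1)"] by (simp add: algebra_simps)
    also have "sqrt ((exp (?n * (sqrt 2 * \<bar>\<sigma>\<bar>)))\<^sup>2) + 2 * exp (?n * (sqrt 2 * \<bar>\<sigma>\<bar>))
        = 3 * exp (?n * (1 + (\<sigma>\<^sup>2 - \<tau>\<^sup>2) / 2 - rem_rate \<beta>))"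
      unfolding r by simp
    finally show ?thesis .
  qed
  then have "expectation ?\<Delta> / norm (rem_mean N \<beta>)
     \<le> 3 * exp (?n * (1 + (\<sigma>\<^sup>2 - \<tau>\<^sup>2) / 2 - rem_rate \<beta>)) / norm (rem_mean N \<beta>)"
    by (intro divide_right_mono) auto
  also have "\<dots> = 3 * exp (?n * (- rem_rate \<beta>))"
  proof -
    have "exp (?n * (1 + (\<sigma>\<^sup>2 - \<tau>\<^sup>2) / 2 - rem_rate \<beta>))
        = exp (?n * (1 + (\<sigma>\<^sup>2 - \<tau>\<^sup>2) / 2)) * exp (?n * (- rem_rate \<beta>))"
      by (simp add: exp_add[symmetric] algebra_simps)
    then show ?thesis unfolding nm by simp
  qed
  also have "\<dots> = 3 * real N powr (- rem_rate \<beta>)"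
    using N by (simp add: powr_def mult.commute)
  finally show "expectation (\<lambda>\<omega>. norm (rem_partition X N \<beta> \<omega> / rem_mean N \<beta> - 1)) \<le> 3 * real N powr (- rem_rate \<beta>)"
    unfolding q by simp
qed

section \<open>Zeros of random holomorphic functions\<close>

lemma circlepath_dist:
  assumes "R \<ge> 0"
  shows "norm (circlepath z R t - z) = R" "circlepath z R t \<in> cball z R"
proof -
  show "norm (circlepath z R t - z) = R"
    using assms by (simp add: circlepath norm_mult)
  then show "circlepath z R t \<in> cball z R" by (simp add: dist_norm norm_minus_commute)
qed

text \<open>
  In the Cauchy integral over the circle of radius \<open>2 * r\<close> the denominator is at least \<open>r\<close> for points
  of the inner disc, so the kernel is at most twice that of the mean value property.
\<close>

lemma norm_le_circle_average:
  fixes f :: "complex \<Rightarrow> complex"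
  assumes r: "r > 0" and f: "f holomorphic_on cball z (2 * r)" and w: "w \<in> cball z r"
  shows "ennreal (norm (f w)) \<le> 2 * (\<integral>\<^sup>+t. ennreal (norm (f (circlepath z (2 * r) t))) * indicator {0..1} t \<partial>lborel)"
proof -
  let ?c = "circlepath z (2 * r)"
  let ?h = "\<lambda>t. norm (f (?c t))"
  have c: "?c t \<in> cball z (2 * r)" "norm (?c t - z) = 2 * r" for t
    using circlepath_dist[of "2 * r" z t] r by simp_all
  have cont: "continuous_on {0..1} ?h"
    by (intro continuous_on_norm continuous_on_compose2[OF holomorphic_on_imp_continuous_on[OF f]])
      (use c in \<open>auto simp: circlepath intro!: continuous_intros\<close>)
  have wz: "norm (w - z) \<le> r" using w by (simp add: dist_norm norm_minus_commute)
  have "((\<lambda>u. f u / (u - w)) has_contour_integral (2 * of_real pi * \<i> * f w)) ?c"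
    using wz r by (intro Cauchy_integral_circlepath_simple[OF f]) linarith
  then have I: "((\<lambda>t. f (?c t) / (?c t - w) * (2 * pi * \<i> * (2 * r) * exp (2 * of_real pi * \<i> * t)))
      has_integral (2 * of_real pi * \<i> * f w)) {0..1}"
    unfolding has_contour_integral_def
    by (rule has_integral_eq[rotated]) (simp add: vector_derivative_circlepath01)
  have "norm (2 * of_real pi * \<i> * f w) \<le> integral {0..1} (\<lambda>t. 4 * pi * ?h t)"
    unfolding integral_unique[OF I, symmetric]
  proof (rule integral_norm_bound_integral)
    show "(\<lambda>t. 4 * pi * ?h t) integrable_on {0..1}"
      by (intro integrable_continuous_interval continuous_intros cont)
    fix t :: real
    have "r \<le> norm (?c t - w)"
      using norm_triangle_ineq2[of "?c t - z" "w - z"] c(2)[of t] wz by simp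
    with r have "?h t / norm (?c t - w) * (4 * pi * r) \<le> ?h t / r * (4 * pi * r)"
      by (intro mult_right_mono divide_left_mono mult_pos_pos) auto
    then show "norm (f (?c t) / (?c t - w) * (2 * pi * \<i> * (2 * r) * exp (2 * of_real pi * \<i> * t))) \<le> 4 * pi * ?h t"
      using r by (simp add: norm_mult norm_divide norm_exp_eq_Re mult_ac)
  qed (use I in blast)
  then have "norm (f w) \<le> 2 * integral {0..1} ?h"
    by (simp add: norm_mult)
  moreover have si: "set_integrable lborel {0..1} ?h"
    by (rule borel_integrable_atLeastAtMost'[OF cont])
  moreover have "(\<integral>\<^sup>+t. ennreal (?h t) * indicator {0..1} t \<partial>lborel) = ennreal (integral {0..1} ?h)"
  proof -
    have "(\<integral>\<^sup>+t. ennreal (?h t) * indicator {0..1} t \<partial>lborel)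
        = (\<integral>\<^sup>+t. ennreal (indicator {0..1} t *\<^sub>R ?h t) \<partial>lborel)"
      by (intro nn_integral_cong) (simp add: indicator_def)
    also have "\<dots> = ennreal (LINT t:{0..1}|lborel. ?h t)"
      using si unfolding set_integrable_def set_lebesgue_integral_def
      by (intro nn_integral_eq_integral) auto
    finally show ?thesis using set_borel_integral_eq_integral(2)[OF si] by simp
  qed
  ultimately show ?thesis
    by (simp add: ennreal_leI ennreal_mult'[symmetric] ennreal_numeral[symmetric] del: ennreal_numeral)
qed

text \<open>
  This replaces a union over uncountably many points by an average.  At a zero of \<open>F\<close> the function
  \<open>F - 1\<close> has modulus one, so on the event \<open>A\<close> its mean modulus over the outer circle is at least
  \<open>1/2\<close>; by Tonelli the expectation of that mean modulus is at most \<open>C\<close>.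
\<close>

lemma (in prob_space) random_holomorphic_zero_prob:
  fixes F :: "complex \<Rightarrow> 'a \<Rightarrow> complex"
  assumes r: "r > 0"
    and hol: "\<And>\<omega>. \<omega> \<in> space M \<Longrightarrow> (\<lambda>w. F w \<omega>) holomorphic_on cball z (2 * r)"
    and meas: "(\<lambda>(w, \<omega>). F w \<omega>) \<in> borel_measurable (borel \<Otimes>\<^sub>M M)"
    and int: "\<And>w. w \<in> cball z (2 * r) \<Longrightarrow> integrable M (\<lambda>\<omega>. norm (F w \<omega> - 1))"
    and bound: "\<And>w. w \<in> cball z (2 * r) \<Longrightarrow> expectation (\<lambda>\<omega>. norm (F w \<omega> - 1)) \<le> C"
    and A: "A \<in> sets M" "\<And>\<omega>. \<omega> \<in> A \<Longrightarrow> \<exists>w\<in>cball z r. F w \<omega> = 0"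
  shows "prob A \<le> 2 * C"
proof -
  let ?c = "circlepath z (2 * r)"
  have cm [measurable]: "?c \<in> borel_measurable lborel"
    unfolding circlepath by (simp add: borel_measurable_continuous_onI continuous_intros)
  have c: "?c t \<in> cball z (2 * r)" for t
    using r by (intro circlepath_dist) simp
  have zC: "0 \<le> C"
    using order_trans[OF integral_nonneg_AE bound[of z]] r by simp
  have "(\<lambda>(t, \<omega>). F (?c t) \<omega>) \<in> borel_measurable (lborel \<Otimes>\<^sub>M M)"
    using measurable_compose[OF _ meas, of "\<lambda>(t, \<omega>). (?c t, \<omega>)" "lborel \<Otimes>\<^sub>M M"]
    by (simp add: case_prod_beta')
  then have Fm: "(\<lambda>p. F (?c (fst p)) (snd p)) \<in> borel_measurable (lborel \<Otimes>\<^sub>M M)"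
    by (simp add: case_prod_beta')
  define G where "G t \<omega> = ennreal (norm (F (?c t) \<omega> - 1)) * indicator {0..1} t" for t \<omega>
  have Gm: "(\<lambda>(t, \<omega>). G t \<omega>) \<in> borel_measurable (lborel \<Otimes>\<^sub>M M)"
    unfolding G_def case_prod_beta' using Fm by measurable
  interpret lM: pair_sigma_finite lborel M ..
  have "ennreal (prob A) = (\<integral>\<^sup>+\<omega>. indicator A \<omega> \<partial>M)"
    using A(1) by (simp add: emeasure_eq_measure)
  also have "\<dots> \<le> (\<integral>\<^sup>+\<omega>. 2 * (\<integral>\<^sup>+t. G t \<omega> \<partial>lborel) \<partial>M)"
  proof (rule nn_integral_mono)
    fix \<omega> assume \<omega>: "\<omega> \<in> space M"
    show "indicator A \<omega> \<le> 2 * (\<integral>\<^sup>+t. G t \<omega> \<partial>lborel)"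
    proof (cases "\<omega> \<in> A")
      case True
      then obtain w where w: "w \<in> cball z r" "F w \<omega> = 0" using A(2) by blast
      have "(\<lambda>w. F w \<omega> - 1) holomorphic_on cball z (2 * r)"
        using hol[OF \<omega>] by (intro holomorphic_intros)
      from norm_le_circle_average[OF r this w(1)] show ?thesis
        using True w(2) by (simp add: G_def)
    qed simp
  qed
  also have "\<dots> = 2 * (\<integral>\<^sup>+\<omega>. (\<integral>\<^sup>+t. G t \<omega> \<partial>lborel) \<partial>M)"
    using measurable_pair_swap[OF Gm]
    by (intro nn_integral_cmult lborel.borel_measurable_nn_integral) (simp add: case_prod_beta')
  also have "(\<integral>\<^sup>+\<omega>. (\<integral>\<^sup>+t. G t \<omega> \<partial>lborel) \<partial>M) = (\<integral>\<^sup>+t. (\<integral>\<^sup>+\<omega>. G t \<omega> \<partial>M) \<partial>lborel)"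
    using lM.Fubini'[OF Gm] by simp
  also have "\<dots> \<le> (\<integral>\<^sup>+t. ennreal C * indicator {0..1} (t::real) \<partial>lborel)"
  proof (rule nn_integral_mono)
    fix t :: real
    have "(\<integral>\<^sup>+\<omega>. ennreal (norm (F (?c t) \<omega> - 1)) \<partial>M) = ennreal (expectation (\<lambda>\<omega>. norm (F (?c t) \<omega> - 1)))"
      by (rule nn_integral_eq_integral[OF int[OF c]]) simp
    also have "\<dots> \<le> ennreal C" using bound[OF c] by (rule ennreal_leI)
    finally show "(\<integral>\<^sup>+\<omega>. G t \<omega> \<partial>M) \<le> ennreal C * indicator {0..1} t"
      unfolding G_def by (cases "t \<in> {0..1}") simp_all
  qed
  also have "\<dots> = ennreal C" by (simp add: nn_integral_cmult_indicator)
  finally have "ennreal (prob A) \<le> 2 * ennreal C" by (simp add: mult_left_mono)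
  then have "ennreal (prob A) \<le> ennreal (2 * C)"
    using zC by (simp add: ennreal_mult)
  then show ?thesis using zC by simp
qed

section \<open>Positivity of the rate on the zero-free region\<close>

text \<open>
  Used to show that points violating the strict inequalities that describe \<open>B1\<close> are limits of points
  of \<open>B2\<close> or \<open>B3\<close>.
\<close>

lemma closure_deformation:
  fixes p :: "real \<Rightarrow> complex"
  assumes "continuous_on UNIV p" "\<And>\<delta>. 0 < \<delta> \<Longrightarrow> \<delta> < 1 \<Longrightarrow> p \<delta> \<in> S"
  shows "p 0 \<in> closure S"
proof (rule Lim_in_closed_set[OF closed_closure])
  show "eventually (\<lambda>\<delta>. p \<delta> \<in> closure S) (at_right 0)"
    using assms(2) closure_subset unfolding eventually_at_right_field by (intro exI[of _ 1]) auto
  show "(p \<longlongrightarrow> p 0) (at_right 0)"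
    using assms(1) by (auto simp: continuous_on_def intro: tendsto_within_subset)
qed simp

lemma B1_imp_rate_pos:
  assumes "\<beta> \<in> B1"
  shows "\<bar>Re \<beta>\<bar> < sqrt 2" and "rem_rate \<beta> > 0"
proof -
  define \<sigma> \<tau> where "\<sigma> = Re \<beta>" and "\<tau> = Im \<beta>"
  have \<beta>: "\<beta> = Complex \<sigma> \<tau>" by (simp add: \<sigma>_def \<tau>_def)
  have nb: "(norm \<beta>)\<^sup>2 = \<sigma>\<^sup>2 + \<tau>\<^sup>2" by (simp add: \<sigma>_def \<tau>_def cmod_power2)
  have notcl: "Complex \<sigma> \<tau> \<notin> closure (B2 \<union> B3)" using assms by (simp add: B1_def \<beta>)
  have "\<bar>\<sigma>\<bar> < sqrt 2 \<and> rem_rate \<beta> > 0"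
  proof (cases "2 * \<sigma>\<^sup>2 \<le> 1")
    case True
    have "\<sigma>\<^sup>2 + \<tau>\<^sup>2 < 1"
    proof (rule ccontr)
      assume ge: "\<not> \<sigma>\<^sup>2 + \<tau>\<^sup>2 < 1"
      \<comment> \<open>as \<open>\<sigma>\<^sup>2 \<le> 1/2 \<le> \<tau>\<^sup>2\<close>, shrinking \<open>\<sigma>\<close> while stretching \<open>\<tau>\<close> leads into \<open>B3\<close>\<close>
      define p where "p \<delta> = Complex ((1 - \<delta>) * \<sigma>) ((1 + \<delta>) * \<tau>)" for \<delta>
      have "p 0 \<in> closure (B2 \<union> B3)"
      proof (rule closure_deformation)
        show "continuous_on UNIV p" unfolding p_def by (intro continuous_intros)
        fix \<delta> :: real assume \<delta>: "0 < \<delta>" "\<delta> < 1"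
        have "(1 - \<delta>)\<^sup>2 * (2 * \<sigma>\<^sup>2) \<le> (1 - \<delta>)\<^sup>2 * 1"
          using True by (intro mult_left_mono) auto
        also have "\<dots> < 1" using \<delta> by (simp add: power_less_one_iff)
        finally have a: "2 * ((1 - \<delta>) * \<sigma>)\<^sup>2 < 1" by (simp add: power_mult_distrib mult_ac)
        have "((1 - \<delta>) * \<sigma>)\<^sup>2 + ((1 + \<delta>) * \<tau>)\<^sup>2 = (\<sigma>\<^sup>2 + \<tau>\<^sup>2) + \<delta>\<^sup>2 * (\<sigma>\<^sup>2 + \<tau>\<^sup>2) + 2 * \<delta> * (\<tau>\<^sup>2 - \<sigma>\<^sup>2)"
          by (simp add: power2_eq_square algebra_simps)
        moreover have "\<delta>\<^sup>2 * (\<sigma>\<^sup>2 + \<tau>\<^sup>2) > 0" using \<delta> ge by (intro mult_pos_pos) auto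
        moreover have "2 * \<delta> * (\<tau>\<^sup>2 - \<sigma>\<^sup>2) \<ge> 0" using \<delta> ge True by (intro mult_nonneg_nonneg) auto
        ultimately have "((1 - \<delta>) * \<sigma>)\<^sup>2 + ((1 + \<delta>) * \<tau>)\<^sup>2 > 1" using ge by linarith
        with a show "p \<delta> \<in> B2 \<union> B3" by (simp add: p_def B3_def)
      qed
      then show False using notcl by (simp add: p_def)
    qed
    moreover have "\<bar>\<sigma>\<bar> < sqrt 2" using True by (intro real_less_rsqrt) (simp add: power2_abs)
    ultimately show ?thesis by (simp add: rem_rate_def nb add_pos_nonneg)
  next
    case False
    have lt: "\<bar>\<sigma>\<bar> + \<bar>\<tau>\<bar> < sqrt 2"
    proof (rule ccontr)
      assume ge: "\<not> \<bar>\<sigma>\<bar> + \<bar>\<tau>\<bar> < sqrt 2"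
      \<comment> \<open>moving away from the origin leads into \<open>B2\<close>\<close>
      define p where "p \<delta> = Complex ((1 + \<delta>) * \<sigma>) ((1 + \<delta>) * \<tau>)" for \<delta>
      have "p 0 \<in> closure (B2 \<union> B3)"
      proof (rule closure_deformation)
        show "continuous_on UNIV p" unfolding p_def by (intro continuous_intros)
        fix \<delta> :: real assume \<delta>: "0 < \<delta>" "\<delta> < 1"
        have "1 * (2 * \<sigma>\<^sup>2) \<le> (1 + \<delta>)\<^sup>2 * (2 * \<sigma>\<^sup>2)"
          using \<delta> by (intro mult_right_mono) auto
        then have a: "2 * ((1 + \<delta>) * \<sigma>)\<^sup>2 > 1" using False by (simp add: power_mult_distrib mult_ac)
        have "1 * sqrt 2 < (1 + \<delta>) * sqrt 2" using \<delta> by (intro mult_strict_right_mono) auto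
        also have "\<dots> \<le> (1 + \<delta>) * (\<bar>\<sigma>\<bar> + \<bar>\<tau>\<bar>)" using \<delta> ge by (intro mult_left_mono) auto
        also have "\<dots> = \<bar>(1 + \<delta>) * \<sigma>\<bar> + \<bar>(1 + \<delta>) * \<tau>\<bar>" using \<delta> by (simp add: abs_mult distrib_left)
        finally show "p \<delta> \<in> B2 \<union> B3" using a by (simp add: p_def B2_def)
      qed
      then show False using notcl by (simp add: p_def)
    qed
    \<comment> \<open>with truncation active the rate is a difference of squares\<close>
    have "sqrt 1 \<le> sqrt (2 * \<sigma>\<^sup>2)" using False by (intro real_sqrt_le_mono) simp
    then have "sqrt 2 * \<bar>\<sigma>\<bar> \<ge> 1" by (simp add: real_sqrt_mult)
    then have "rem_rate \<beta> = ((sqrt 2 - \<bar>\<sigma>\<bar>)\<^sup>2 - \<tau>\<^sup>2) / 2"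
      unfolding rem_rate_def nb \<sigma>_def[symmetric]
      by (simp add: max_def power2_diff power_mult_distrib field_simps)
    moreover have "\<bar>\<tau>\<bar>\<^sup>2 < (sqrt 2 - \<bar>\<sigma>\<bar>)\<^sup>2" using lt by (intro power_strict_mono) auto
    ultimately show ?thesis using lt by auto
  qed
  then show "\<bar>Re \<beta>\<bar> < sqrt 2" "rem_rate \<beta> > 0" by (simp_all add: \<sigma>_def)
qed

text \<open>
  The disc of doubled radius leaves room for the circle of the Cauchy estimate.
\<close>

lemma B1_locally_uniform_rate:
  assumes "z \<in> B1"
  obtains r \<epsilon> where "r > 0" "\<epsilon> > 0"
    "\<And>w. w \<in> cball z (2 * r) \<Longrightarrow> \<bar>Re w\<bar> \<le> sqrt 2 \<and> \<epsilon> \<le> rem_rate w"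
proof -
  let ?U = "{w. \<bar>Re w\<bar> < sqrt 2 \<and> rem_rate z / 2 < rem_rate w}"
  have "continuous_on UNIV rem_rate"
    unfolding rem_rate_def by (intro continuous_intros) auto
  then have "open ?U"
    by (intro open_Collect_conj open_Collect_less continuous_intros)
  moreover have "z \<in> ?U" using B1_imp_rate_pos[OF assms] by simp
  ultimately obtain e where "e > 0" "cball z e \<subseteq> ?U" by (meson open_contains_cball)
  then show ?thesis
    using B1_imp_rate_pos(2)[OF assms] by (intro that[of "e / 2" "rem_rate z / 2"]) auto
qed

section \<open>Zeros of the partition function\<close>

lemma rem_ratio_measurable_pair:
  fixes M :: "'a measure" and X :: "nat \<Rightarrow> 'a \<Rightarrow> real"
  assumes X: "\<And>k. k \<ge> 1 \<Longrightarrow> X k \<in> borel_measurable M"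
  shows "(\<lambda>(w, \<omega>). rem_partition X N w \<omega> / rem_mean N w) \<in> borel_measurable (borel \<Otimes>\<^sub>M M)"
proof -
  have e [measurable]: "(exp :: complex \<Rightarrow> complex) \<in> borel_measurable borel"
    by (intro borel_measurable_continuous_onI continuous_intros)
  have m [measurable]: "rem_mean N \<in> borel_measurable borel"
    unfolding rem_mean_def by (intro borel_measurable_continuous_onI continuous_intros) auto
  have "(\<lambda>p :: complex \<times> 'a. \<Sum>k=1..N. exp (fst p * of_real (sqrt (ln (real N)) * X k (snd p))))
      \<in> borel_measurable (borel \<Otimes>\<^sub>M M)"
  proof (rule borel_measurable_sum)
    fix k assume "k \<in> {1..N}"
    then have [measurable]: "X k \<in> borel_measurable M" using X by simp
    show "(\<lambda>p :: complex \<times> 'a. exp (fst p * of_real (sqrt (ln (real N)) * X k (snd p)))) \<in> borel_measurable (borel \<Otimes>\<^sub>M M)"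
      by measurable
  qed
  then have [measurable]: "(\<lambda>p. rem_partition X N (fst p) (snd p)) \<in> borel_measurable (borel \<Otimes>\<^sub>M M)"
    by (simp add: rem_partition_def)
  show ?thesis unfolding case_prod_beta' by measurable
qed

lemma rem_ratio_holomorphic: "N \<ge> 1 \<Longrightarrow> (\<lambda>w. rem_partition X N w \<omega> / rem_mean N w) holomorphic_on A"
  unfolding rem_partition_def rem_mean_def by (intro holomorphic_intros) auto

lemma (in prob_space) rem_zero_prob_disc:
  fixes X :: "nat \<Rightarrow> 'a \<Rightarrow> real"
  assumes ind: "indep_vars (\<lambda>_. borel) X {1..}"
    and law: "\<And>k. k \<ge> 1 \<Longrightarrow> distr M borel (X k) = std_normal_distribution"
    and N: "N \<ge> 1" and r: "r > 0"
    and rate: "\<And>w. w \<in> cball z (2 * r) \<Longrightarrow> \<bar>Re w\<bar> \<le> sqrt 2 \<and> \<epsilon> \<le> rem_rate w"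
    and K: "compact K" "K \<subseteq> cball z r"
  shows "prob {\<omega> \<in> space M. \<exists>\<beta>\<in>K. rem_partition X N \<beta> \<omega> = 0} \<le> 6 * real N powr (- \<epsilon>)"
proof -
  have X: "X k \<in> borel_measurable M" if "k \<ge> 1" for k
    using ind that by (auto simp: indep_vars_def)
  have "prob {\<omega> \<in> space M. \<exists>\<beta>\<in>K. rem_partition X N \<beta> \<omega> = 0} \<le> 2 * (3 * real N powr (- \<epsilon>))"
  proof (rule random_holomorphic_zero_prob[OF r, where F = "\<lambda>w \<omega>. rem_partition X N w \<omega> / rem_mean N w" and z = z])
    show "(\<lambda>(w, \<omega>). rem_partition X N w \<omega> / rem_mean N w) \<in> borel_measurable (borel \<Otimes>\<^sub>M M)"
      by (rule rem_ratio_measurable_pair[OF X])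
    show "{\<omega> \<in> space M. \<exists>\<beta>\<in>K. rem_partition X N \<beta> \<omega> = 0} \<in> sets M"
      by (rule rem_zero_event_measurable[OF X K(1)])
    fix w assume w: "w \<in> cball z (2 * r)"
    note L1 = rem_L1_deviation[OF ind law N conjunct1[OF rate[OF w]]]
    show "integrable M (\<lambda>\<omega>. norm (rem_partition X N w \<omega> / rem_mean N w - 1))"
      by (rule L1)
    have "3 * real N powr (- rem_rate w) \<le> 3 * real N powr (- \<epsilon>)"
      using rate[OF w] N by (intro mult_left_mono powr_mono) auto
    with L1(2) show "expectation (\<lambda>\<omega>. norm (rem_partition X N w \<omega> / rem_mean N w - 1)) \<le> 3 * real N powr (- \<epsilon>)"
      by (rule order_trans)
  qed (use K(2) N in \<open>auto intro!: rem_ratio_holomorphic\<close>)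
  then show ?thesis by simp
qed

theorem theorem2p5:
  fixes M :: "'a measure" and X :: "nat \<Rightarrow> 'a \<Rightarrow> real" and K :: "complex set"
  assumes "prob_space M"
    and "prob_space.indep_vars M (\<lambda>_. borel) X {1..}"
    and "\<And>k. k \<ge> 1 \<Longrightarrow> distributed M lborel (X k) std_normal_density"
    and "compact K" and "K \<subseteq> B1"
  shows "\<exists>\<epsilon>>0. (\<lambda>N::nat. measure M {\<omega> \<in> space M. \<exists>\<beta>\<in>K. rem_partition X N \<beta> \<omega> = 0})
           \<in> O(\<lambda>N. real N powr - \<epsilon>)"
proof -
  interpret prob_space M by (rule assms)
  have X: "X k \<in> borel_measurable M" if "k \<ge> 1" for k
    using distributed_measurable[OF assms(3)[OF that]] by simp
  have law: "distr M borel (X k) = std_normal_distribution" if "k \<ge> 1" for k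
    using distributed_distr_eq_density[OF assms(3)[OF that]] by (simp cong: distr_cong)
  have "\<forall>z\<in>K. \<exists>r e. r > 0 \<and> e > 0 \<and> (\<forall>w\<in>cball z (2 * r). \<bar>Re w\<bar> \<le> sqrt 2 \<and> e \<le> rem_rate w)"
    using assms(5) by (metis B1_locally_uniform_rate subsetD)
  then obtain r e where re: "\<And>z. z \<in> K \<Longrightarrow> r z > 0" "\<And>z. z \<in> K \<Longrightarrow> e z > (0::real)"
    "\<And>z w. z \<in> K \<Longrightarrow> w \<in> cball z (2 * r z) \<Longrightarrow> \<bar>Re w\<bar> \<le> sqrt 2 \<and> e z \<le> rem_rate w"
    by metis
  have "K \<subseteq> (\<Union>z\<in>K. ball z (r z))"
    using re(1) by fastforce
  then obtain C where C: "C \<subseteq> K" "finite C" "K \<subseteq> (\<Union>z\<in>C. ball z (r z))"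
    by (rule compactE_image[OF assms(4) open_ball])
  \<comment> \<open>the \<open>1\<close> keeps the minimum meaningful for empty \<open>C\<close>, that is, for empty \<open>K\<close>\<close>
  define \<epsilon> where "\<epsilon> = Min (insert 1 (e ` C))"
  have \<epsilon>: "\<epsilon> > 0" "\<And>z. z \<in> C \<Longrightarrow> \<epsilon> \<le> e z"
    using C(1,2) re(2) by (auto simp: \<epsilon>_def)
  let ?E = "\<lambda>L N. {\<omega> \<in> space M. \<exists>\<beta>\<in>L. rem_partition X N \<beta> \<omega> = 0}"
  have bound: "prob (?E K N) \<le> 6 * card C * real N powr (- \<epsilon>)" if N: "N \<ge> 1" for N
  proof -
    have cpt: "compact (K \<inter> cball z (r z))" for z using assms(4) by (intro compact_Int) auto
    have ev: "?E (K \<inter> cball z (r z)) N \<in> events" for z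
      by (rule rem_zero_event_measurable[OF X cpt])
    have "K \<subseteq> (\<Union>z\<in>C. K \<inter> cball z (r z))"
      using C(3) by (force simp: less_imp_le)
    then have "?E K N \<subseteq> (\<Union>z\<in>C. ?E (K \<inter> cball z (r z)) N)"
      by blast
    then have "prob (?E K N) \<le> prob (\<Union>z\<in>C. ?E (K \<inter> cball z (r z)) N)"
      using ev C(2) by (intro finite_measure_mono sets.finite_UN) auto
    also have "\<dots> \<le> (\<Sum>z\<in>C. prob (?E (K \<inter> cball z (r z)) N))"
      using ev C(2) by (intro finite_measure_subadditive_finite) auto
    also have "\<dots> \<le> (\<Sum>z\<in>C. 6 * real N powr (- \<epsilon>))"
    proof (rule sum_mono)
      fix z assume z: "z \<in> C"
      then have zK: "z \<in> K" using C(1) by blast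
      show "prob (?E (K \<inter> cball z (r z)) N) \<le> 6 * real N powr (- \<epsilon>)"
        using re(3)[OF zK] \<epsilon>(2)[OF z]
        by (intro rem_zero_prob_disc[OF assms(2) law N re(1)[OF zK] _ cpt]) (auto intro: order_trans)
    qed
    finally show ?thesis by (simp add: mult_ac)
  qed
  have "(\<lambda>N. prob (?E K N)) \<in> O(\<lambda>N. real N powr - \<epsilon>)"
    by (rule bigoI[where c = "6 * card C"]) (use bound in \<open>auto intro!: eventually_sequentiallyI[of 1]\<close>)
  then show ?thesis using \<epsilon>(1) by blast
qed

end
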